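(* No mechanism simultaneously satisfies ex-post favoring-eagerness-for-remaining-items (ep-FERI) and sd-envy-freeness (sd-EF).
   Context: Setting. An assignment problem has a set $N=\{1,\dots,n\}$ of agents and a set $M$ of $n$ items (one unit each). A preference profile $R=(\succ_j)_{j\in N}$ gives each agent $j$ a strict linear order $\succ_j$ on $M$. For nonempty $S\subseteq M$, $\mathrm{top}(j,S)$ is the $\succ_j$-best item of $S$. A random assignment is a doubly stochastic $n\times n$ matrix $P=[p_{j,o}]$ with rows $P_j$. A deterministic assignment is a bijection $A:N\to M$, identified with its permutation matrix. A mechanism assigns to every preference profile (of every assignment problem, of any size $n$) a random assignment; it satisfies a property of random assignments if its output satisfies it for every profile. FERI. For a deterministic assignment $A$ define recursively for $r=1,2,\dots$: $T_{A,r}=\{o\in M: o=\mathrm{top}(j,M\setminus\bigcup_{r'<r}T_{A,r'})\text{ for some }j\in N\text{ with }A(j)\notin\bigcup_{r'<r}T_{A,r'}\}$. $A$ satisfies FERI if for every $r\ge 1$ and every $o\in T_{A,r}$, $o=\mathrm{top}(A^{-1}(o),M\setminus\bigcup_{r'<r}T_{A,r'})$. A random assignment satisfies ep-FERI if it is a convex combination of deterministic assignments satisfying FERI. Stochastic dominance. $U(\succ,o)=\{o'\in M:o'\succ o\}\cup\{o\}$. For probability vectors $p,q$ on $M$, $p\succeq^{sd}_jq$ means $\sum_{o'\in U(\succ_j,o)}p_{o'}\ge\sum_{o'\in U(\succ_j,o)}q_{o'}$ for all $o\in M$. sd-EF: $P$ is sd-EF if $P_j\succeq^{sd}_jP_k$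 for all $j,k\in N$. *)

theory Defs
  imports Main "HOL.Real" "HOL-Library.FuncSet" "HOL-Library.Infinite_Typeclass"
begin

text \<open>
  A preference of an agent is a strict linear order on the item set \<open>M\<close>, given as a relation
  in which \<open>(x, y)\<close> means that \<open>x\<close> is strictly preferred to \<open>y\<close>. The library predicate
  \<^const>\<open>strict_linear_order_on\<close> does not confine the relation to \<open>M\<close>; this is added, so that
  a profile carries no information beyond the preferences on \<open>M\<close>.
\<close>

type_synonym 'a preference = "('a \<times> 'a) set"
type_synonym 'a profile = "nat \<Rightarrow> 'a preference"

definition agents :: "nat \<Rightarrow> nat set" where
  "agents n = {1..n}"

definition preferences :: "'a set \<Rightarrow> 'a preference set" where
  "preferences M = {r. r \<subseteq> M \<times> M \<and> strict_linear_order_on M r}"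

definition assignment_problem :: "nat \<Rightarrow> 'a set \<Rightarrow> 'a profile \<Rightarrow> bool" where
  "assignment_problem n M R \<longleftrightarrow>
     1 \<le> n \<and> finite M \<and> card M = n \<and> R \<in> agents n \<rightarrow>\<^sub>E preferences M"

definition top_item :: "'a preference \<Rightarrow> 'a set \<Rightarrow> 'a" where
  "top_item r S = (THE x. x \<in> S \<and> (\<forall>y\<in>S. y \<noteq> x \<longrightarrow> (x, y) \<in> r))"

text \<open>
  Matrices have rows indexed by agents and columns indexed by items; only the entries
  in \<open>agents n \<times> M\<close> are meaningful.
\<close>

type_synonym 'a assignment_matrix = "nat \<Rightarrow> 'a \<Rightarrow> real"

definition random_assignment :: "nat \<Rightarrow> 'a set \<Rightarrow> 'a assignment_matrix \<Rightarrow> bool" where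
  "random_assignment n M P \<longleftrightarrow>
     (\<forall>j\<in>agents n. \<forall>x\<in>M. 0 \<le> P j x) \<and>
     (\<forall>j\<in>agents n. (\<Sum>x\<in>M. P j x) = 1) \<and>
     (\<forall>x\<in>M. (\<Sum>j\<in>agents n. P j x) = 1)"

definition deterministic_assignment :: "nat \<Rightarrow> 'a set \<Rightarrow> (nat \<Rightarrow> 'a) \<Rightarrow> bool" where
  "deterministic_assignment n M A \<longleftrightarrow> bij_betw A (agents n) M"

definition permutation_matrix :: "(nat \<Rightarrow> 'a) \<Rightarrow> 'a assignment_matrix" where
  "permutation_matrix A j x = (if A j = x then 1 else 0)"

text \<open>
  The rounds \<open>r\<close> start at 1; the value at \<open>r = 0\<close> is never used.
\<close>

fun FERI_T :: "nat \<Rightarrow> 'a set \<Rightarrow> 'a profile \<Rightarrow> (nat \<Rightarrow> 'a) \<Rightarrow> nat \<Rightarrow> 'a set" where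
  "FERI_T n M R A r =
     {x \<in> M. \<exists>j\<in>agents n. A j \<notin> (\<Union>r'\<in>{1..<r}. FERI_T n M R A r') \<and>
                 x = top_item (R j) (M - (\<Union>r'\<in>{1..<r}. FERI_T n M R A r'))}"

declare FERI_T.simps [simp del]

definition FERI :: "nat \<Rightarrow> 'a set \<Rightarrow> 'a profile \<Rightarrow> (nat \<Rightarrow> 'a) \<Rightarrow> bool" where
  "FERI n M R A \<longleftrightarrow>
     (\<forall>r\<ge>1. \<forall>x\<in>FERI_T n M R A r.
        x = top_item (R (inv_into (agents n) A x)) (M - (\<Union>r'\<in>{1..<r}. FERI_T n M R A r')))"

definition ep_FERI :: "nat \<Rightarrow> 'a set \<Rightarrow> 'a profile \<Rightarrow> 'a assignment_matrix \<Rightarrow> bool" where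
  "ep_FERI n M R P \<longleftrightarrow>
     (\<exists>\<A> w. finite \<A> \<and>
        (\<forall>A\<in>\<A>. deterministic_assignment n M A \<and> FERI n M R A) \<and>
        (\<forall>A\<in>\<A>. 0 \<le> w A) \<and> (\<Sum>A\<in>\<A>. w A) = 1 \<and>
        (\<forall>j\<in>agents n. \<forall>x\<in>M. P j x = (\<Sum>A\<in>\<A>. w A * permutation_matrix A j x)))"

definition upper_contour :: "'a set \<Rightarrow> 'a preference \<Rightarrow> 'a \<Rightarrow> 'a set" where
  "upper_contour M r x = {y \<in> M. (y, x) \<in> r} \<union> {x}"

definition sd_weakly_prefers ::
    "'a set \<Rightarrow> 'a preference \<Rightarrow> ('a \<Rightarrow> real) \<Rightarrow> ('a \<Rightarrow> real) \<Rightarrow> bool" where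
  "sd_weakly_prefers M r p q \<longleftrightarrow>
     (\<forall>x\<in>M. (\<Sum>y\<in>upper_contour M r x. p y) \<ge> (\<Sum>y\<in>upper_contour M r x. q y))"

definition sd_EF :: "nat \<Rightarrow> 'a set \<Rightarrow> 'a profile \<Rightarrow> 'a assignment_matrix \<Rightarrow> bool" where
  "sd_EF n M R P \<longleftrightarrow>
     (\<forall>j\<in>agents n. \<forall>k\<in>agents n. sd_weakly_prefers M (R j) (P j) (P k))"

text \<open>
  A mechanism takes the whole assignment problem (its size, its item set and its profile) as
  input. The item sets are the finite subsets of a type \<open>'a\<close>, which must be infinite for
  there to be problems of every size.
\<close>

type_synonym 'a assignment_rule = "nat \<Rightarrow> 'a set \<Rightarrow> 'a profile \<Rightarrow> 'a assignment_matrix"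

definition satisfies_property ::
    "'a assignment_rule \<Rightarrow>
     (nat \<Rightarrow> 'a set \<Rightarrow> 'a profile \<Rightarrow> 'a assignment_matrix \<Rightarrow> bool) \<Rightarrow> bool" where
  "satisfies_property f Q \<longleftrightarrow>
     (\<forall>n M R. assignment_problem n M R \<longrightarrow> Q n M R (f n M R))"

definition mechanism :: "'a assignment_rule \<Rightarrow> bool" where
  "mechanism f \<longleftrightarrow> (\<forall>n M R. assignment_problem n M R \<longrightarrow> random_assignment n M (f n M R))"

end

theory Submission imports Defs begin

text \<open>
  Three agents suffice: agents 1 and 2 rank \<open>a \<succ> b \<succ> c\<close> and agent 3 ranks \<open>b \<succ> a \<succ> c\<close>. Agent 3
  alone has \<open>b\<close> on top, so every FERI assignment gives \<open>b\<close> to agent 3, who thus receives \<open>b\<close> with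
  probability 1. Not envying agent 3, agents 1 and 2 must then each receive \<open>a\<close> or \<open>b\<close> with
  total probability 1, so the columns of \<open>a\<close> and \<open>b\<close> would sum to at least 3 instead of 2.
\<close>

definition ranking3 :: "'a \<Rightarrow> 'a \<Rightarrow> 'a \<Rightarrow> 'a preference" where
  "ranking3 x y z = {(x, y), (x, z), (y, z)}"

lemma ranking3_in_preferences:
  assumes "distinct [x, y, z]"
  shows "ranking3 x y z \<in> preferences {x, y, z}"
  using assms
  by (auto simp: preferences_def ranking3_def strict_linear_order_on_def trans_def irrefl_def
      total_on_def)

lemma top_item_ranking3:
  assumes "distinct [x, y, z]"
  shows "top_item (ranking3 x y z) {x, y, z} = x"
  unfolding top_item_def
proof (rule the_equality)
  show "x \<in> {x, y, z} \<and> (\<forall>u\<in>{x, y, z}. u \<noteq> x \<longrightarrow> (x, u) \<in> ranking3 x y z)"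
    by (simp add: ranking3_def)
next
  fix v
  assume "v \<in> {x, y, z} \<and> (\<forall>u\<in>{x, y, z}. u \<noteq> v \<longrightarrow> (v, u) \<in> ranking3 x y z)"
  then have "v \<noteq> x \<longrightarrow> (v, x) \<in> ranking3 x y z"
    by simp
  then show "v = x"
    using assms by (simp add: ranking3_def)
qed

text \<open>At the second-ranked item, stochastic dominance compares the total probability of the
  two best items.\<close>

lemma upper_contour_ranking3:
  assumes "distinct [x, y, z]"
  shows "upper_contour {x, y, z} (ranking3 x y z) y = {x, y}"
  using assms by (auto simp: upper_contour_def ranking3_def)

text \<open>Nothing has been removed before round 1, so FERI hands each item allocated in that round
  to an agent who ranks it first in all of \<open>M\<close>; by uniqueness this can only be
  \<open>j\<close>.\<close>

lemma FERI_unique_top: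
  assumes A: "deterministic_assignment n M A" and "FERI n M R A"
    and j: "j \<in> agents n" and M: "top_item (R j) M \<in> M"
    and unique: "\<And>k. k \<in> agents n \<Longrightarrow> top_item (R k) M = top_item (R j) M \<Longrightarrow> k = j"
  shows "A j = top_item (R j) M"
proof -
  let ?x = "top_item (R j) M"
  let ?k = "inv_into (agents n) A ?x"
  \<comment> \<open>The range \<open>{1..<1}\<close> of earlier rounds is empty, so \<open>j\<close>
    itself witnesses membership.\<close>
  have "?x \<in> FERI_T n M R A 1"
    using j M by (subst FERI_T.simps) auto
  then have "?x = top_item (R ?k) (M - (\<Union>r'\<in>{1..<1}. FERI_T n M R A r'))"
    using \<open>FERI n M R A\<close> unfolding FERI_def by blast
  moreover have "?x \<in> A ` agents n"
    using A M by (simp add: deterministic_assignment_def bij_betw_def)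
  ultimately have "?k = j"
    by (intro unique) (auto intro: inv_into_into)
  then show ?thesis
    using f_inv_into_f[OF \<open>?x \<in> A ` agents n\<close>] by simp
qed

text \<open>Every assignment in the convex combination gives \<open>j\<close> the same item, so the
  entry is the sum of all weights.\<close>

lemma ep_FERI_unique_top:
  assumes "ep_FERI n M R P"
    and j: "j \<in> agents n" and M: "top_item (R j) M \<in> M"
    and unique: "\<And>k. k \<in> agents n \<Longrightarrow> top_item (R k) M = top_item (R j) M \<Longrightarrow> k = j"
  shows "P j (top_item (R j) M) = 1"
proof -
  obtain \<A> w where \<A>: "\<forall>A\<in>\<A>. deterministic_assignment n M A \<and> FERI n M R A"
    and w: "(\<Sum>A\<in>\<A>. w A) = 1"
    and P: "\<forall>j\<in>agents n. \<forall>x\<in>M. P j x = (\<Sum>A\<in>\<A>. w A * permutation_matrix A j x)"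
    using \<open>ep_FERI n M R P\<close> unfolding ep_FERI_def by (elim exE conjE) (rule that)
  have "A j = top_item (R j) M" if "A \<in> \<A>" for A
  proof (rule FERI_unique_top)
    show "deterministic_assignment n M A" "FERI n M R A"
      using \<A> that by auto
  qed (fact j M unique)+
  then have "(\<Sum>A\<in>\<A>. w A * permutation_matrix A j (top_item (R j) M)) = (\<Sum>A\<in>\<A>. w A)"
    by (simp add: permutation_matrix_def)
  then show ?thesis
    using P j M w by simp
qed

theorem proposition4:
  "\<not> (\<exists>f :: 'a::infinite assignment_rule.
        mechanism f \<and> satisfies_property f ep_FERI \<and> satisfies_property f sd_EF)"
proof
  assume "\<exists>f :: 'a assignment_rule.
        mechanism f \<and> satisfies_property f ep_FERI \<and> satisfies_property f sd_EF"
  then obtain f :: "'a assignment_rule" where f: "mechanism f"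
    "satisfies_property f ep_FERI" "satisfies_property f sd_EF" by blast
  obtain M :: "'a set" where M: "finite M" "card M = 3"
    using infinite_arbitrarily_large[OF infinite_UNIV] by blast
  then obtain a b c where abc: "M = {a, b, c}" "distinct [a, b, c]"
    by (auto simp: card_3_iff)
  \<comment> \<open>The lemmas on \<open>ranking3\<close> write the item set in the order of the
    ranking; agent 3 needs this second form.\<close>
  have bac: "distinct [b, a, c]" "M = {b, a, c}"
    using abc by auto
  \<comment> \<open>The restricted lambda makes the profile extensional, as
    \<open>assignment_problem\<close> demands.\<close>
  define R where
    "R = (\<lambda>j\<in>agents 3. if j = 3 then ranking3 b a c else ranking3 a b c)"
  have agents: "agents 3 = {1, 2, 3}"
    by (auto simp: agents_def)
  have R: "R 1 = ranking3 a b c" "R 2 = ranking3 a b c" "R 3 = ranking3 b a c"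
    by (simp_all add: R_def agents)
  have "ranking3 a b c \<in> preferences M" "ranking3 b a c \<in> preferences M"
    using ranking3_in_preferences[OF abc(2)] ranking3_in_preferences[OF bac(1)] abc(1) bac(2)
    by simp_all
  then have problem: "assignment_problem 3 M R"
    using M by (simp add: assignment_problem_def R_def)
  define P where "P = f 3 M R"
  have P: "random_assignment 3 M P" "ep_FERI 3 M R P" "sd_EF 3 M R P"
    using f problem by (simp_all add: mechanism_def satisfies_property_def P_def)
  have top: "top_item (R 1) M = a" "top_item (R 2) M = a" "top_item (R 3) M = b"
    unfolding R using top_item_ranking3[OF abc(2)] top_item_ranking3[OF bac(1)] abc(1) bac(2)
    by simp_all
  have "P 3 (top_item (R 3) M) = 1"
  proof (rule ep_FERI_unique_top[OF P(2)])
    fix k assume "k \<in> agents 3" "top_item (R k) M = top_item (R 3) M"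
    then show "k = 3" using top abc(2) by (auto simp: agents)
  qed (use top abc(1) in \<open>simp_all add: agents\<close>)
  then have P3b: "P 3 b = 1"
    by (simp add: top)
  \<comment> \<open>This is sd-envy-freeness towards agent 3 evaluated at \<open>b\<close>, whose
    upper contour set for \<open>j\<close> is \<open>{a, b}\<close>.\<close>
  have no_envy: "P j a + P j b \<ge> P 3 a + P 3 b" if "j \<in> {1, 2}" for j
  proof -
    have "R j = ranking3 a b c" using that R by auto
    moreover have "sd_weakly_prefers M (R j) (P j) (P 3)"
      using P(3) that by (auto simp: sd_EF_def agents)
    ultimately show ?thesis
      using upper_contour_ranking3[OF abc(2)] abc by (auto simp: sd_weakly_prefers_def)
  qed
  have "P 1 a + P 2 a + P 3 a = 1" "P 1 b + P 2 b + P 3 b = 1" "P 3 a \<ge> 0"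
    using P(1) abc(1) by (auto simp: random_assignment_def agents)
  \<comment> \<open>Adding the columns of \<open>a\<close> and \<open>b\<close> gives 2 on one side
    and at least 3 + 3 * \<open>P 3 a\<close> on the other.\<close>
  then show False
    using no_envy[of 1] no_envy[of 2] P3b by simp
qed

end
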